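(* Let $\mathbb{A}=\{A_1,A_2,\ldots\}$ be any set of positive integers. Suppose that $\lambda=(B_1^{m_1},\ldots, B_k^{m_k})$ is a nonempty partition whose parts come from $\mathbb{A}$, and let $M=\sum_{i=1}^k m_i B_i$. Then $$ \frac{1-q^M}{1-wq^M}\prod_{i\ge 1} (1-q^{A_i})^{-1}=\sum_{\mu} q^{\|\mu\|} w^{E_\lambda(\mu)}, $$ where the sum is over all partitions $\mu$ (including the empty one) with parts from $\mathbb{A}$.
   Context: The elements $A_i$ of $\mathbb{A}$ are listed without repetition. The notation $(B_1^{m_1},\ldots,B_k^{m_k})$ denotes the partition with distinct part sizes $B_s$ occurring with multiplicities $m_s\ge1$. $\|\mu\|$ is the sum of the parts of $\mu$. The number of times $\lambda$ appears in $\mu$ is $$E_\lambda(\mu)=\max\{j\ge 0:\ \mu \text{ contains at least } jm_s \text{ parts of size } B_s \text{ for all } s\}.$$ $w$ is an indeterminate and the identity is one of formal power series in $q$ with coefficients polynomial in $w$. *)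

theory Defs
  imports
    "HOL-Analysis.Analysis"
    "HOL-Library.Multiset"
    "HOL-Computational_Algebra.Polynomial"
    "HOL-Computational_Algebra.Formal_Power_Series"
begin

text \<open>
  Partitions are finite multisets of positive integers: the part sizes \<open>B\<^sub>s\<close> of \<open>lam\<close> are the
  elements of \<^term>\<open>set_mset lam\<close>, the multiplicity \<open>m\<^sub>s\<close> is \<^term>\<open>count lam B\<^sub>s\<close>, and \<open>\<parallel>\<mu>\<parallel>\<close> is
  \<^term>\<open>sum_mset \<mu>\<close>.
\<close>

definition partitions_with_parts :: "nat set \<Rightarrow> nat multiset set" where
  "partitions_with_parts S = {\<mu>. set_mset \<mu> \<subseteq> S \<and> 0 \<notin># \<mu>}"

text \<open>The set below has a maximum only for \<open>lam \<noteq> {#}\<close>; it always contains \<open>0\<close>.\<close>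

definition num_appearances :: "nat multiset \<Rightarrow> nat multiset \<Rightarrow> nat" where
  "num_appearances lam \<mu> = Max {j. \<forall>b\<in>set_mset lam. j * count lam b \<le> count \<mu> b}"

lemma finite_num_appearances:
  assumes "lam \<noteq> {#}"
  shows "finite {j. \<forall>b\<in>set_mset lam. j * count lam b \<le> count \<mu> b}"
proof -
  obtain b where b: "b \<in># lam" using assms by blast
  hence "count lam b \<ge> 1" by simp
  have "{j. \<forall>b\<in>set_mset lam. j * count lam b \<le> count \<mu> b} \<subseteq> {..count \<mu> b}"
  proof clarify
    fix j assume "\<forall>b\<in>set_mset lam. j * count lam b \<le> count \<mu> b"
    with b have "j * count lam b \<le> count \<mu> b" by blast
    moreover have "j * 1 \<le> j * count lam b" using \<open>count lam b \<ge> 1\<close> by (intro mult_le_mono) auto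
    ultimately show "j \<le> count \<mu> b" by linarith
  qed
  thus ?thesis by (rule finite_subset) simp
qed

text \<open>
  The coefficient ring \<open>\<int>[w]\<close> is not of class \<^class>\<open>inverse\<close>, so \<open>1 / f\<close> is not available for
  power series over it; series with constant term \<open>1\<close> are nevertheless invertible.
\<close>

definition fps_recip :: "'a::comm_ring_1 fps \<Rightarrow> 'a fps" where
  "fps_recip f = fps_right_inverse f 1"

lemma fps_recip:
  assumes "fps_nth f 0 = 1"
  shows "f * fps_recip f = 1"
  using assms unfolding fps_recip_def by (intro fps_right_inverse) simp

text \<open>The indeterminate \<open>w\<close>, as an element of \<open>\<int>[w]\<close>; \<open>q\<close> is \<^const>\<open>fps_X\<close>.\<close>

definition wvar :: "int poly" where
  "wvar = [:0, 1:]"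

end

theory Submission
  imports Defs
begin

text \<open>
  Adding the parts of \<open>lam\<close> to a partition \<open>\<mu>\<close> raises its size by \<open>M = \<parallel>lam\<parallel>\<close> and its number of
  appearances of \<open>lam\<close> by one, and it is a bijection onto the partitions that contain \<open>lam\<close>.  So
  for the series \<open>W = (\<Sum>\<mu>. q^\<parallel>\<mu>\<parallel> w^E(\<mu>))\<close> the product \<open>w q^M W\<close> is the part of \<open>W\<close> contributed by
  the partitions containing \<open>lam\<close>.  The remaining partitions have \<open>E(\<mu>) = 0\<close>, hence
  \<open>(1 - w q^M) W\<close> counts the partitions that avoid \<open>lam\<close>, with weight one each
  (\<open>appearances_partition_gf\<close>).  For the generating function \<open>G\<close> of all partitions, the same shift
  shows that \<open>(1 - q^M) G\<close> counts these partitions as well (\<open>avoiding_partition_gf\<close>).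
  Equating the two expressions and dividing by \<open>1 - w q^M\<close> gives the identity, once \<open>G\<close> is known
  to be the infinite product.

  For the latter, the one-part partition \<open>{#a#}\<close> can play the role of \<open>lam\<close>: avoiding it means
  having no part \<open>a\<close>, so multiplying by \<open>1 - q^a\<close> removes \<open>a\<close> from the set of permitted parts
  (\<open>partition_gf_insert\<close>).  Induction yields the product formula for finitely many parts.
  In the topology of formal power series, convergence means that every coefficient is eventually
  constant.  This holds for the partial products because parts larger than \<open>n\<close> do not affect the
  coefficient of \<open>q^n\<close>, and for the sum over all \<open>\<mu>\<close> because only finitely many partitions have
  size \<open>n\<close>.
\<close>

section \<open>Partitions of a given number\<close>

definition partitions_of :: "nat set \<Rightarrow> nat \<Rightarrow> nat multiset set" where
  "partitions_of S n = {\<mu> \<in> partitions_with_parts S. sum_mset \<mu> = n}"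

lemma finite_partitions_of: "finite (partitions_of S n)"
proof (rule finite_subset)
  show "partitions_of S n \<subseteq> (\<Union>k\<le>n. multisets_of_size {..n} k)"
  proof
    fix \<mu> assume "\<mu> \<in> partitions_of S n"
    hence pos: "0 \<notin># \<mu>" and total: "sum_mset \<mu> = n"
      by (auto simp: partitions_of_def partitions_with_parts_def)
    have "size \<mu> \<le> sum_mset \<mu>"
      using pos by (induction \<mu>) auto
    moreover have "set_mset \<mu> \<subseteq> {..n}"
      using total by (auto dest: multi_member_split)
    ultimately show "\<mu> \<in> (\<Union>k\<le>n. multisets_of_size {..n} k)"
      using total by (auto simp: multisets_of_size_def)
  qed
  show "finite (\<Union>k\<le>n. multisets_of_size {..n} k)"
    by (intro finite_UN_I finite_multisets_of_size) auto
qed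

lemma sum_mset_conv_count:
  "sum_mset \<mu> = (\<Sum>b\<in>set_mset \<mu>. count \<mu> b * b)" for \<mu> :: "nat multiset"
proof (induction \<mu>)
  case (add a \<mu>)
  have "(\<Sum>b\<in>set_mset (add_mset a \<mu>). count (add_mset a \<mu>) b * b) =
        (\<Sum>b\<in>set_mset (add_mset a \<mu>). count \<mu> b * b + (if b = a then a else 0))"
    by (intro sum.cong) auto
  also have "\<dots> = (\<Sum>b\<in>set_mset (add_mset a \<mu>). count \<mu> b * b) + a"
    by (simp add: sum.distrib)
  also have "(\<Sum>b\<in>set_mset (add_mset a \<mu>). count \<mu> b * b) = (\<Sum>b\<in>set_mset \<mu>. count \<mu> b * b)"
    by (intro sum.mono_neutral_right) (auto simp: count_eq_zero_iff)
  finally show ?case using add.IH by simp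
qed simp

text \<open>The shift by \<open>lam\<close>, the one combinatorial fact from which all the identities below follow.\<close>

lemma bij_betw_add_partition:
  assumes "lam \<in> partitions_with_parts S"
  shows "bij_betw (\<lambda>\<mu>. \<mu> + lam) (partitions_of S n)
           {\<mu> \<in> partitions_of S (n + sum_mset lam). lam \<subseteq># \<mu>}"
proof (rule bij_betwI[where g = "\<lambda>\<mu>. \<mu> - lam"])
  show "(\<lambda>\<mu>. \<mu> + lam) \<in> partitions_of S n \<rightarrow> {\<mu> \<in> partitions_of S (n + sum_mset lam). lam \<subseteq># \<mu>}"
    using assms by (auto simp: partitions_of_def partitions_with_parts_def)
  show "(\<lambda>\<mu>. \<mu> - lam) \<in> {\<mu> \<in> partitions_of S (n + sum_mset lam). lam \<subseteq># \<mu>} \<rightarrow> partitions_of S n"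
    by (auto simp: partitions_of_def partitions_with_parts_def subset_mset.le_iff_add)
qed auto

section \<open>Weighted generating functions\<close>

text \<open>
  The series is defined by its coefficients, which are finite sums, so that the algebra below is
  free of convergence questions; \<open>has_sum_partition_gf\<close> identifies it with the sum over all
  partitions.  The weight is arbitrary so that all partitions, those avoiding \<open>lam\<close>, and those
  weighted by a power of \<open>w\<close> are instances of the same series.
\<close>

definition partition_gf :: "nat set \<Rightarrow> (nat multiset \<Rightarrow> 'a::comm_ring_1) \<Rightarrow> 'a fps" where
  "partition_gf S f = Abs_fps (\<lambda>n. \<Sum>\<mu>\<in>partitions_of S n. f \<mu>)"

lemma partition_gf_cong:
  assumes "\<And>\<mu>. \<mu> \<in> partitions_with_parts S \<Longrightarrow> f \<mu> = g \<mu>"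
  shows "partition_gf S f = partition_gf S g"
  using assms unfolding partition_gf_def
  by (intro fps_ext) (auto simp: partitions_of_def intro!: sum.cong)

lemma partition_gf_diff:
  "partition_gf S f - partition_gf S g = partition_gf S (\<lambda>\<mu>. f \<mu> - g \<mu>)"
  by (rule fps_ext) (simp add: partition_gf_def sum_subtractf)

lemma fps_const_mult_partition_gf:
  "fps_const c * partition_gf S f = partition_gf S (\<lambda>\<mu>. c * f \<mu>)"
  by (rule fps_ext) (simp add: partition_gf_def sum_distrib_left)

text \<open>
  The shift by \<open>lam\<close> in terms of generating functions: the partition that a term of the product
  counts is the shifted one, so its weight is read off after removing \<open>lam\<close> again.
\<close>

lemma fps_X_power_mult_partition_gf:
  assumes "lam \<in> partitions_with_parts S"
  shows "fps_X ^ sum_mset lam * partition_gf S f =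
         partition_gf S (\<lambda>\<mu>. if lam \<subseteq># \<mu> then f (\<mu> - lam) else 0)"
proof (rule fps_ext)
  fix n
  let ?g = "\<lambda>\<mu>. if lam \<subseteq># \<mu> then f (\<mu> - lam) else 0"
  have restrict: "(\<Sum>\<mu>\<in>partitions_of S n. ?g \<mu>) =
      (\<Sum>\<mu>\<in>{\<mu> \<in> partitions_of S n. lam \<subseteq># \<mu>}. f (\<mu> - lam))"
    by (intro sum.inter_filter [symmetric] finite_partitions_of)
  show "fps_nth (fps_X ^ sum_mset lam * partition_gf S f) n = fps_nth (partition_gf S ?g) n"
  proof (cases "n < sum_mset lam")
    case True
    \<comment> \<open>Both coefficients vanish: a partition of \<open>n\<close> is too small to contain \<open>lam\<close>.\<close>
    have "\<not> lam \<subseteq># \<mu>" if "\<mu> \<in> partitions_of S n" for \<mu>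
      using that True by (auto simp: partitions_of_def subset_mset.le_iff_add)
    hence "{\<mu> \<in> partitions_of S n. lam \<subseteq># \<mu>} = {}"
      by blast
    with True show ?thesis
      by (simp only: partition_gf_def fps_nth_Abs_fps restrict fps_X_power_mult_nth) simp
  next
    case False
    hence "bij_betw (\<lambda>\<mu>. \<mu> + lam) (partitions_of S (n - sum_mset lam))
             {\<mu> \<in> partitions_of S n. lam \<subseteq># \<mu>}"
      using bij_betw_add_partition[OF assms, of "n - sum_mset lam"] by simp
    from sum.reindex_bij_betw[OF this, of "\<lambda>\<mu>. f (\<mu> - lam)"] False show ?thesis
      by (simp only: partition_gf_def fps_nth_Abs_fps restrict fps_X_power_mult_nth) simp
  qed
qed

lemma avoiding_partition_gf:
  assumes "lam \<in> partitions_with_parts S"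
  shows "(1 - fps_X ^ sum_mset lam) * partition_gf S (\<lambda>_. 1) =
         partition_gf S (\<lambda>\<mu>. if lam \<subseteq># \<mu> then 0 else 1)"
proof -
  have "(1 - fps_X ^ sum_mset lam) * partition_gf S (\<lambda>_. 1) =
        partition_gf S (\<lambda>_. 1) - partition_gf S (\<lambda>\<mu>. if lam \<subseteq># \<mu> then 1 else 0)"
    by (simp add: left_diff_distrib fps_X_power_mult_partition_gf[OF assms])
  also have "\<dots> = partition_gf S (\<lambda>\<mu>. if lam \<subseteq># \<mu> then 0 else 1)"
    unfolding partition_gf_diff by (rule partition_gf_cong) simp
  finally show ?thesis .
qed

section \<open>Counting appearances\<close>

text \<open>
  The maximum is used only through this Galois-style characterisation.  Sizes \<open>b\<close> that do not
  occur in \<open>lam\<close> impose no condition, which allows quantification over all \<open>b\<close> and hence a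
  termwise comparison of multiplicities.
\<close>

lemma le_num_appearances_iff:
  assumes "lam \<noteq> {#}"
  shows "j \<le> num_appearances lam \<mu> \<longleftrightarrow> (\<forall>b. j * count lam b \<le> count \<mu> b)"
proof -
  let ?J = "{j. \<forall>b\<in>set_mset lam. j * count lam b \<le> count \<mu> b}"
  have fin: "finite ?J" by (rule finite_num_appearances[OF assms])
  have "0 \<in> ?J" by simp
  hence max: "num_appearances lam \<mu> \<in> ?J"
    unfolding num_appearances_def using Max_in[OF fin] by blast
  have "(\<forall>b. j * count lam b \<le> count \<mu> b) \<longleftrightarrow> j \<in> ?J"
    by (auto simp: not_in_iff)
  moreover have "j \<in> ?J \<longleftrightarrow> j \<le> num_appearances lam \<mu>"
  proof
    assume "j \<in> ?J"
    thus "j \<le> num_appearances lam \<mu>"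
      unfolding num_appearances_def by (rule Max_ge[OF fin])
  next
    assume "j \<le> num_appearances lam \<mu>"
    hence "j * count lam b \<le> num_appearances lam \<mu> * count lam b" for b
      by (rule mult_le_mono1)
    with max show "j \<in> ?J"
      using order.trans by blast
  qed
  ultimately show ?thesis by blast
qed

lemma num_appearances_eq_0:
  assumes "lam \<noteq> {#}" "\<not> lam \<subseteq># \<mu>"
  shows "num_appearances lam \<mu> = 0"
  using le_num_appearances_iff[OF assms(1), of 1 \<mu>] assms(2)
  by (auto simp: subseteq_mset_def)

text \<open>
  Having \<open>Suc j\<close> copies of \<open>lam\<close> in \<open>\<mu> + lam\<close> and having \<open>j\<close> copies in \<open>\<mu>\<close> are the same condition on
  multiplicities, and a natural number is determined by its lower bounds.
\<close>

lemma num_appearances_add: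
  assumes "lam \<noteq> {#}"
  shows "num_appearances lam (\<mu> + lam) = Suc (num_appearances lam \<mu>)"
proof -
  have step: "Suc j \<le> num_appearances lam (\<mu> + lam) \<longleftrightarrow> j \<le> num_appearances lam \<mu>" for j
    by (simp only: le_num_appearances_iff[OF assms]) simp
  from step[of 0] obtain k where k: "num_appearances lam (\<mu> + lam) = Suc k"
    by (cases "num_appearances lam (\<mu> + lam)") auto
  from step k have "j \<le> k \<longleftrightarrow> j \<le> num_appearances lam \<mu>" for j
    by simp
  hence "k = num_appearances lam \<mu>" by (intro order.antisym) auto
  with k show ?thesis by simp
qed

text \<open>
  Multiplying by \<open>w\<close> while shifting by \<open>lam\<close> compensates the additional appearance, so the
  subtraction cancels every partition that contains \<open>lam\<close> exactly, whatever its weight.  The right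
  side is free of \<open>w\<close> and agrees with that of \<open>avoiding_partition_gf\<close>.
\<close>

lemma appearances_partition_gf:
  fixes w :: "'a::comm_ring_1"
  assumes "lam \<in> partitions_with_parts S" "lam \<noteq> {#}"
  shows "(1 - fps_const w * fps_X ^ sum_mset lam) * partition_gf S (\<lambda>\<mu>. w ^ num_appearances lam \<mu>) =
         partition_gf S (\<lambda>\<mu>. if lam \<subseteq># \<mu> then 0 else 1)"
proof -
  have appear: "num_appearances lam \<mu> = Suc (num_appearances lam (\<mu> - lam))" if "lam \<subseteq># \<mu>" for \<mu>
    using num_appearances_add[OF assms(2), of "\<mu> - lam"] that by simp
  have "(1 - fps_const w * fps_X ^ sum_mset lam) * partition_gf S (\<lambda>\<mu>. w ^ num_appearances lam \<mu>) =
        partition_gf S (\<lambda>\<mu>. w ^ num_appearances lam \<mu>) -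
        partition_gf S (\<lambda>\<mu>. w * (if lam \<subseteq># \<mu> then w ^ num_appearances lam (\<mu> - lam) else 0))"
    by (simp add: left_diff_distrib mult.assoc fps_X_power_mult_partition_gf[OF assms(1)]
          fps_const_mult_partition_gf)
  also have "\<dots> = partition_gf S (\<lambda>\<mu>. if lam \<subseteq># \<mu> then 0 else 1)"
    unfolding partition_gf_diff
    by (rule partition_gf_cong) (simp add: appear num_appearances_eq_0[OF assms(2)])
  finally show ?thesis .
qed

section \<open>Euler's product for partitions\<close>

lemma fps_recip_unique:
  assumes "fps_nth f 0 = 1" "f * g = h"
  shows "g = fps_recip f * h"
proof -
  have "fps_recip f * h = (f * fps_recip f) * g"
    unfolding assms(2) [symmetric] by (simp only: mult_ac)
  thus ?thesis by (simp add: fps_recip[OF assms(1)])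
qed

text \<open>
  The case \<open>lam = {#a#}\<close> of \<open>avoiding_partition_gf\<close>: the partitions avoiding the part \<open>a\<close> are those
  with parts from \<open>S\<close> alone.
\<close>

lemma partition_gf_insert:
  assumes "a > 0" "a \<notin> S"
  shows "(1 - fps_X ^ a) * partition_gf (insert a S) (\<lambda>_. 1) = partition_gf S (\<lambda>_. 1)"
proof -
  have "{#a#} \<in> partitions_with_parts (insert a S)"
    using assms(1) by (simp add: partitions_with_parts_def)
  from avoiding_partition_gf[OF this]
  have "(1 - fps_X ^ a) * partition_gf (insert a S) (\<lambda>_. 1) =
        (partition_gf (insert a S) (\<lambda>\<mu>. if a \<in># \<mu> then 0 else 1) :: 'a fps)"
    by simp
  also have "\<dots> = partition_gf S (\<lambda>_. 1)"
  proof (rule fps_ext)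
    fix n
    have "partitions_of S n = {\<mu> \<in> partitions_of (insert a S) n. a \<notin># \<mu>}"
      using assms(2) by (auto simp: partitions_of_def partitions_with_parts_def)
    hence "(\<Sum>\<mu>\<in>partitions_of (insert a S) n. if a \<in># \<mu> then 0 else 1 :: 'a) = (\<Sum>\<mu>\<in>partitions_of S n. 1)"
      by (intro sum.mono_neutral_cong_right finite_partitions_of) auto
    thus "fps_nth (partition_gf (insert a S) (\<lambda>\<mu>. if a \<in># \<mu> then 0 else 1) :: 'a fps) n =
          fps_nth (partition_gf S (\<lambda>_. 1)) n"
      by (simp only: partition_gf_def fps_nth_Abs_fps)
  qed
  finally show ?thesis .
qed

lemma partition_gf_finite:
  assumes "finite S" "0 \<notin> S"
  shows "(\<Prod>a\<in>S. fps_recip (1 - fps_X ^ a)) = partition_gf S (\<lambda>_. 1)"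
  using assms
proof (induction S)
  case empty
  have "partitions_of {} n = (if n = 0 then {{#}} else {})" for n
    by (auto simp: partitions_of_def partitions_with_parts_def)
  thus ?case
    by (intro fps_ext) (simp add: partition_gf_def)
next
  case (insert a S)
  hence "a > 0" by simp
  with insert have "partition_gf (insert a S) (\<lambda>_. 1) =
      fps_recip (1 - fps_X ^ a) * (partition_gf S (\<lambda>_. 1) :: 'a fps)"
    by (intro fps_recip_unique partition_gf_insert) auto
  with insert show ?case by simp
qed

lemma fps_nth_0_partition_gf [simp]: "fps_nth (partition_gf S f) 0 = f {#}"
proof -
  have "partitions_of S 0 = {{#}}"
    by (auto simp: partitions_of_def partitions_with_parts_def) (metis multiset_nonemptyE)
  thus ?thesis by (simp add: partition_gf_def)
qed

text \<open>
  A partial product counts the partitions whose parts have an index up to \<open>n\<close>.  Since \<open>A\<close> is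
  injective, only finitely many indices belong to parts of size at most \<open>m\<close>, and once these are
  included the coefficient of \<open>q^m\<close> no longer changes.
\<close>

lemma has_prod_partition_gf:
  fixes A :: "nat \<Rightarrow> nat"
  assumes "inj_on A I" "0 \<notin> A ` I"
  shows "(\<lambda>i. if i \<in> I then fps_recip (1 - fps_X ^ A i) else 1) has_prod
           (partition_gf (A ` I) (\<lambda>_. 1) :: 'a::comm_ring_1 fps)"
proof -
  let ?f = "\<lambda>i. if i \<in> I then fps_recip (1 - fps_X ^ A i) else (1 :: 'a fps)"
  have partial: "(\<Prod>i\<le>n. ?f i) = partition_gf (A ` (I \<inter> {..n})) (\<lambda>_. 1)" for n
  proof -
    have "(\<Prod>i\<le>n. ?f i) = (\<Prod>i\<in>I \<inter> {..n}. fps_recip (1 - fps_X ^ A i))"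
      by (subst Int_commute, rule prod.inter_restrict [symmetric]) simp
    also have "\<dots> = (\<Prod>a\<in>A ` (I \<inter> {..n}). fps_recip (1 - fps_X ^ a))"
      using inj_on_subset[OF assms(1)] by (subst prod.reindex) auto
    also have "\<dots> = partition_gf (A ` (I \<inter> {..n})) (\<lambda>_. 1)"
      using assms(2) by (intro partition_gf_finite) auto
    finally show ?thesis .
  qed
  have "(\<lambda>n. \<Prod>i\<le>n. ?f i) \<longlonglongrightarrow> partition_gf (A ` I) (\<lambda>_. 1)"
  proof (rule tendsto_fpsI)
    fix m
    have "finite {i \<in> I. A i \<le> m}"
      using finite_vimage_IntI[OF _ assms(1), of "{..m}"] by (simp add: vimage_def Int_def conj_commute)
    then obtain k where k: "i \<le> k" if "i \<in> I" "A i \<le> m" for i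
      by (metis (mono_tags, lifting) finite_nat_set_iff_bounded_le mem_Collect_eq)
    have "partitions_of (A ` (I \<inter> {..n})) m = partitions_of (A ` I) m" if "n \<ge> k" for n
    proof -
      have "x \<in> A ` (I \<inter> {..n})" if "x \<in># \<mu>" "\<mu> \<in> partitions_of (A ` I) m" for x \<mu>
      proof -
        have "x \<le> m" "x \<in> A ` I"
          using that by (auto simp: partitions_of_def partitions_with_parts_def dest: multi_member_split)
        thus ?thesis using k \<open>n \<ge> k\<close> order.trans by blast
      qed
      thus ?thesis
        by (auto simp: partitions_of_def partitions_with_parts_def)
    qed
    hence "\<forall>n\<ge>k. fps_nth (\<Prod>i\<le>n. ?f i) m = fps_nth (partition_gf (A ` I) (\<lambda>_. 1)) m"
      unfolding partial by (simp add: partition_gf_def)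
    thus "\<forall>\<^sub>F n in sequentially. fps_nth (\<Prod>i\<le>n. ?f i) m = fps_nth (partition_gf (A ` I) (\<lambda>_. 1)) m"
      unfolding eventually_sequentially by blast
  qed
  \<comment> \<open>Convergence of an infinite product includes that the limit is nonzero.\<close>
  moreover have "(partition_gf (A ` I) (\<lambda>_. 1) :: 'a fps) \<noteq> 0"
    by (metis fps_nth_0_partition_gf fps_zero_nth zero_neq_one)
  ultimately show ?thesis
    unfolding has_prod_def raw_has_prod_def add_0_right by blast
qed

section \<open>The sum over all partitions and the identity\<close>

text \<open>
  Every finite set of partitions that includes all partitions of \<open>n\<close> already gives the final
  coefficient of \<open>q^n\<close>.
\<close>

lemma has_sum_partition_gf:
  "((\<lambda>\<mu>. fps_X ^ sum_mset \<mu> * fps_const (f \<mu>)) has_sum partition_gf S f) (partitions_with_parts S)"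
  unfolding has_sum_def
proof (rule tendsto_fpsI)
  fix n
  let ?t = "\<lambda>\<mu>. fps_X ^ sum_mset \<mu> * fps_const (f \<mu>)"
  have "fps_nth (sum ?t F) n = fps_nth (partition_gf S f) n"
    if F: "finite F" "partitions_of S n \<subseteq> F" "F \<subseteq> partitions_with_parts S" for F
  proof -
    have "fps_nth (sum ?t F) n = (\<Sum>\<mu>\<in>F. if sum_mset \<mu> = n then f \<mu> else 0)"
      by (auto simp: fps_sum_nth fps_X_power_mult_nth intro!: sum.cong)
    also have "\<dots> = (\<Sum>\<mu>\<in>partitions_of S n. f \<mu>)"
      using F by (intro sum.mono_neutral_cong_right) (auto simp: partitions_of_def)
    finally show ?thesis by (simp add: partition_gf_def)
  qed
  moreover have "partitions_of S n \<subseteq> partitions_with_parts S"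
    by (auto simp: partitions_of_def)
  ultimately show "\<forall>\<^sub>F F in finite_subsets_at_top (partitions_with_parts S).
      fps_nth (sum ?t F) n = fps_nth (partition_gf S f) n"
    unfolding eventually_finite_subsets_at_top using finite_partitions_of
    by (intro exI[of _ "partitions_of S n"]) auto
qed

theorem proposition6p5:
  fixes AA :: "nat set" and I :: "nat set" and A :: "nat \<Rightarrow> nat"
    and lam :: "nat multiset" and M :: nat
  assumes "\<forall>a\<in>AA. a > 0"
    and "bij_betw A I AA"
    and "lam \<in> partitions_with_parts AA" and "lam \<noteq> {#}"
    and "M = (\<Sum>b\<in>set_mset lam. count lam b * b)"
  shows "convergent_prod (\<lambda>i. if i \<in> I then fps_recip (1 - fps_X ^ A i :: int poly fps) else 1) \<and>
    (\<lambda>\<mu>. fps_X ^ sum_mset \<mu> * fps_const (wvar ^ num_appearances lam \<mu>))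
      summable_on partitions_with_parts AA \<and>
    (1 - fps_X ^ M) * fps_recip (1 - fps_const wvar * fps_X ^ M) *
      (\<Prod>i. if i \<in> I then fps_recip (1 - fps_X ^ A i) else 1) =
    (\<Sum>\<^sub>\<infinity>\<mu>\<in>partitions_with_parts AA.
      fps_X ^ sum_mset \<mu> * fps_const (wvar ^ num_appearances lam \<mu>))"
proof -
  let ?G = "partition_gf AA (\<lambda>_. 1) :: int poly fps"
  let ?W = "partition_gf AA (\<lambda>\<mu>. wvar ^ num_appearances lam \<mu>)"
  have M: "M = sum_mset lam"
    unfolding assms(5) by (rule sum_mset_conv_count [symmetric])
  have AA: "A ` I = AA" and inj: "inj_on A I"
    using assms(2) by (auto simp: bij_betw_def)
  have prod: "(\<lambda>i. if i \<in> I then fps_recip (1 - fps_X ^ A i) else 1) has_prod ?G"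
    using has_prod_partition_gf[OF inj] assms(1) AA by auto
  have sum: "((\<lambda>\<mu>. fps_X ^ sum_mset \<mu> * fps_const (wvar ^ num_appearances lam \<mu>)) has_sum ?W)
      (partitions_with_parts AA)"
    by (rule has_sum_partition_gf)
  have "M > 0"
    using assms(3,4) unfolding M partitions_with_parts_def
    by (auto dest: multi_nonempty_split)
  have "(1 - fps_const wvar * fps_X ^ M) * ?W = (1 - fps_X ^ M) * ?G"
    using appearances_partition_gf[OF assms(3,4)] avoiding_partition_gf[OF assms(3)] M by metis
  hence "?W = fps_recip (1 - fps_const wvar * fps_X ^ M) * ((1 - fps_X ^ M) * ?G)"
    using \<open>M > 0\<close> by (intro fps_recip_unique) auto
  moreover have "convergent_prod (\<lambda>i. if i \<in> I then fps_recip (1 - fps_X ^ A i :: int poly fps) else 1)"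
    using prod unfolding has_prod_def convergent_prod_def by blast
  ultimately show ?thesis
    using has_prod_unique[OF prod] infsumI[OF sum] sum
    by (auto simp: mult_ac summable_on_def)
qed

end
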